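(* Let $p\in\mathcal A_h$, let $q\in T((\mathbb R^d))$ be such that $|q^\emptyset|<1$, and assume there exists $\varphi\in T((\mathbb R^d))$, with well-defined resolvent $(\emptyset-\varphi)^{-1}$, such that $$q\preceq\varphi\quad\text{and}\quad(\emptyset-\varphi)^{-1}\in\mathcal A_h.$$ Then the resolvent $(\emptyset-q)^{-1}$ is well-defined and belongs to $\mathcal A_h$. Furthermore, the unique solution $\ell\in T((\mathbb R^d))$ of the linear equation $\ell=p+\ell q$ belongs to $\mathcal A_h$.
   Context: Let $d\ge2$ and $T>0$. $V_n$ is the set of words of length $n$ in the letters $\mathbf 1,\dots,\mathbf d$, $V_0=\{\emptyset\}$, $V=\bigcup_nV_n$. $T((\mathbb R^d))$ is the space of formal series $\ell=\sum_{n\ge0}\sum_{v\in V_n}\ell^vv$ with $\ell^v\in\mathbb R$. The product $\ell\varphi$ is concatenation, $(\ell\varphi)^w=\sum_{uv=w}\ell^u\varphi^v$, with unit $\emptyset$. For $q$ with $q^\emptyset\ne1$ the resolvent is $(\emptyset-q)^{-1}:=\sum_{n\ge0}(1-q^\emptyset)^{-(n+1)}(q-q^\emptyset\emptyset)^{\otimes n}$. Write $\ell\preceq\varphi$ if $|\ell^v|\le\varphi^v$ for all $v\in V$. For a word $v$, $n(v)$ is its length and $x(v)$ its number of occurrences of the letter $\mathbf 1$. With a fixed constant $C\ge2$ (independent of $v$ and $t$), set $$h_t(v)=\frac{C}{(n(v)+1)^{1/4}}\,\frac{(2t)^{\frac12(n(v)+x(v))}}{\sqrt{(n(v)+x(v)-1)!}},$$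 with $k!=1$ for $k\le0$. Here $C$ is chosen so that $\mathbb E[\sup_{s\le t}|\widehat{\mathbb W}_s^v|^2]\le h_t(v)^2$ for all words $v$ and $t\in[0,T]$, where $\widehat{\mathbb W}$ is the Stratonovich signature of $(t,W^2_t,\dots,W^d_t)$ with $W$ a $(d-1)$-dimensional Brownian motion. Let $\|\ell\|_t^{\mathcal A_h}=\sum_{n\ge0}\sum_{v\in V_n}|\ell^v|h_t(v)$ and $\mathcal A_h=\{\ell\in T((\mathbb R^d)):\|\ell\|_T^{\mathcal A_h}<\infty\}$. *)

theory Defs
  imports Complex_Main "HOL-Library.Extended_Nonnegative_Real" "HOL-Library.Cardinality"
begin

text \<open>
  The alphabet is a finite type \<open>'d\<close> with \<open>CARD('d) = d\<close>; words are lists over \<open>'d\<close>, so that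
  every function on \<open>'d list\<close> is an element of \<open>T((R^d))\<close>. The distinguished letter
  (the one of the time component) is passed as an explicit argument \<open>e\<close>.
\<close>

type_synonym 'd series = "'d list \<Rightarrow> real"

definition words :: "nat \<Rightarrow> 'd list set" where
  "words n = {v. length v = n}"

definition cat_one :: "'d series" where
  "cat_one w = (if w = [] then 1 else 0)"

definition cat :: "'d series \<Rightarrow> 'd series \<Rightarrow> 'd series" (infixl "\<otimes>" 70) where
  "(l \<otimes> p) w = (\<Sum>(u, v) | u @ v = w. l u * p v)"

primrec cat_pow :: "'d series \<Rightarrow> nat \<Rightarrow> 'd series" where
  "cat_pow l 0 = cat_one"
| "cat_pow l (Suc n) = l \<otimes> cat_pow l n"

definition resolvent_term :: "'d series \<Rightarrow> nat \<Rightarrow> 'd series" where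
  "resolvent_term q n w =
     inverse (1 - q []) ^ (n + 1) * cat_pow (\<lambda>v. q v - q [] * cat_one v) n w"

definition resolvent_defined :: "'d series \<Rightarrow> bool" where
  "resolvent_defined q \<longleftrightarrow> q [] \<noteq> 1 \<and> (\<forall>w. summable (\<lambda>n. resolvent_term q n w))"

definition resolvent :: "'d series \<Rightarrow> 'd series" where
  "resolvent q w = (\<Sum>n. resolvent_term q n w)"

definition dominated :: "'d series \<Rightarrow> 'd series \<Rightarrow> bool" (infix "\<preceq>" 50) where
  "l \<preceq> p \<longleftrightarrow> (\<forall>v. \<bar>l v\<bar> \<le> p v)"

text \<open>
  The factor \<open>(2t)^((n + x)/2)\<close> is written as a power of \<open>sqrt (2 * t)\<close> because \<open>0 powr 0 = 0\<close>.
  The natural-number subtraction yields the convention that the factorial of \<open>-1\<close> is \<open>1\<close>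
  (which is needed only for the empty word).
\<close>

definition h_weight :: "real \<Rightarrow> 'd \<Rightarrow> real \<Rightarrow> 'd list \<Rightarrow> real" where
  "h_weight C e t v =
     (let n = length v; x = count_list v e in
        C / (real n + 1) powr (1/4) * (sqrt (2 * t) ^ (n + x) / sqrt (fact (n + x - 1))))"

definition A_norm :: "real \<Rightarrow> 'd \<Rightarrow> real \<Rightarrow> 'd::finite series \<Rightarrow> ennreal" where
  "A_norm C e t l = (\<Sum>n. \<Sum>v\<in>words n. ennreal (\<bar>l v\<bar> * h_weight C e t v))"

definition A_space :: "real \<Rightarrow> 'd \<Rightarrow> real \<Rightarrow> 'd::finite series set" where
  "A_space C e T = {l. A_norm C e T l < \<infinity>}"

text \<open>
  The series defining the resolvent is a finite sum in every coefficient, so the only actual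
  requirement is that the coefficient of the empty word differs from \<open>1\<close>.
\<close>

lemma cat_pow_eq_0:
  assumes "a [] = 0" "length w < n"
  shows "cat_pow a n w = 0"
  using assms(2)
proof (induction n arbitrary: w)
  case 0
  then show ?case by simp
next
  case (Suc n)
  have "a u * cat_pow a n v = 0" if "u @ v = w" for u v
  proof (cases "u = []")
    case True
    then show ?thesis using assms(1) by simp
  next
    case False
    then have "length v < n" using that Suc.prems by (cases u) auto
    then show ?thesis using Suc.IH by simp
  qed
  then show ?case by (auto simp: cat_def intro!: sum.neutral)
qed

lemma resolvent_defined_iff: "resolvent_defined q \<longleftrightarrow> q [] \<noteq> 1"
proof -
  have "summable (\<lambda>n. resolvent_term q n w)" for w
    by (rule summable_finite[of "{..length w}"])
       (auto simp: resolvent_term_def cat_pow_eq_0 cat_one_def)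
  then show ?thesis by (simp add: resolvent_defined_def)
qed

end

theory Submission
  imports Defs
begin

text \<open>
  The weights \<open>h\<close> make \<open>A_h\<close> an algebra in which every series without constant term is
  quasi-nilpotent. Indeed, the factorial in the denominator gives, for a nonempty word \<open>u\<close>,
  \<open>h(uv) \<le> h(u) h(v) / sqrt(max 1 |v|)\<close> (\<open>decaying_weight_h_weight\<close>). A series \<open>s\<close> with
  \<open>s [] = 0\<close> has powers \<open>s\<^sup>n\<close> supported on words of length at least \<open>n\<close>, so each further
  multiplication by \<open>s\<close> gains a factor \<open>1 / sqrt n\<close>, the norm of \<open>s\<^sup>n\<close> is at most of the order
  of \<open>B\<^sup>n / sqrt ((n - 1)!)\<close>, and the geometric series of every scalar multiple of \<open>s\<close> converges in
  \<open>A_h\<close>. Hence \<open>A_h\<close> contains the resolvent of each of its elements whose constant term is not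
  \<open>1\<close> (\<open>finite_wnorm_resolvent\<close>).

  The theorem follows by inverting twice. Write \<open>r\<close> for the resolvent of \<open>\<phi>\<close>. As \<open>r\<close> is the
  inverse of \<open>[] - \<phi>\<close>, the series \<open>[] - \<phi>\<close> is the resolvent of \<open>[] - r\<close>
  (\<open>resolvent_one_minus_resolvent\<close>) and hence lies in \<open>A_h\<close>. So \<open>\<phi>\<close> lies in \<open>A_h\<close>, so does
  the dominated series \<open>q\<close>, and so does the resolvent of \<open>q\<close>. This route compares only \<open>q\<close>
  with \<open>\<phi>\<close>, never their resolvents: if \<open>\<phi> [] > 1\<close>, the terms of the resolvent of \<open>\<phi>\<close>
  alternate in sign, and it need not dominate the resolvent of \<open>q\<close> term by term. Finally, the
  equation \<open>l = p + l q\<close> says \<open>l ([] - q) = p\<close>, so its only solution is \<open>p\<close> times the resolvent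
  of \<open>q\<close>, a product of two elements of \<open>A_h\<close>.
\<close>

section \<open>The concatenation algebra\<close>

lemma finite_splits: "finite {(u, v). u @ v = w}"
proof -
  have "{(u, v). u @ v = w} \<subseteq> (\<lambda>i. (take i w, drop i w)) ` {..length w}"
  proof clarify
    fix u v :: "'a list"
    show "(u, v) \<in> (\<lambda>i. (take i (u @ v), drop i (u @ v))) ` {..length (u @ v)}"
      by (rule image_eqI[where x = "length u"]) auto
  qed
  then show ?thesis by (rule finite_subset) simp
qed

lemma cat_Nil [simp]: "(l \<otimes> p) [] = l [] * p []"
proof -
  have "{(u, v). u @ v = []} = {([], [])}" by auto
  then show ?thesis by (simp add: cat_def)
qed

text \<open>
  Splitting off the first letter obeys a product rule. It allows the
  associativity of concatenation to be proved by induction on the word, without a bijection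
  between nested splittings.
\<close>

lemma cat_Cons: "(l \<otimes> p) (x # w) = l [] * p (x # w) + ((\<lambda>u. l (x # u)) \<otimes> p) w"
proof -
  let ?S = "{(u, v). u @ v = w}"
  let ?f = "\<lambda>(u, v). (x # u, v)"
  have eq: "{(u, v). u @ v = x # w} = insert ([], x # w) (?f ` ?S)"
    by (auto simp: append_eq_Cons_conv)
  have inj: "inj_on ?f ?S" by (auto simp: inj_on_def)
  have "(\<Sum>(u, v)\<in>?f ` ?S. l u * p v) = (\<Sum>(u, v)\<in>?S. l (x # u) * p v)"
    by (subst sum.reindex[OF inj]) (simp add: case_prod_unfold)
  then show ?thesis
    unfolding cat_def eq by (subst sum.insert) (auto simp: finite_splits)
qed

lemma cat_cong:
  assumes "\<And>v. length v \<le> length w \<Longrightarrow> p v = p' v"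
  shows "(l \<otimes> p) w = (l \<otimes> p') w"
  unfolding cat_def by (rule sum.cong) (auto intro!: assms)

lemma cat_add_left: "((\<lambda>v. l v + m v) \<otimes> p) w = (l \<otimes> p) w + (m \<otimes> p) w"
  by (simp add: cat_def case_prod_unfold algebra_simps sum.distrib)

lemma cat_diff_left: "((\<lambda>v. l v - m v) \<otimes> p) w = (l \<otimes> p) w - (m \<otimes> p) w"
  by (simp add: cat_def case_prod_unfold algebra_simps sum_subtractf)

lemma cat_scale_left: "((\<lambda>v. c * l v) \<otimes> p) w = c * (l \<otimes> p) w"
  by (simp add: cat_def case_prod_unfold sum_distrib_left mult.assoc)

lemma cat_diff_right: "(p \<otimes> (\<lambda>v. l v - m v)) w = (p \<otimes> l) w - (p \<otimes> m) w"
  by (simp add: cat_def case_prod_unfold algebra_simps sum_subtractf)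

lemma cat_scale_right: "(p \<otimes> (\<lambda>v. c * l v)) w = c * (p \<otimes> l) w"
  by (simp add: cat_def case_prod_unfold sum_distrib_left mult_ac)

lemma cat_sum_right: "(p \<otimes> (\<lambda>v. \<Sum>k\<in>A. f k v)) w = (\<Sum>k\<in>A. (p \<otimes> f k) w)"
  unfolding cat_def case_prod_unfold sum_distrib_left by (rule sum.swap)

lemma cat_assoc: "(l \<otimes> p) \<otimes> r = l \<otimes> (p \<otimes> r)"
proof
  fix w
  show "((l \<otimes> p) \<otimes> r) w = (l \<otimes> (p \<otimes> r)) w"
    by (induction w arbitrary: l)
       (simp_all add: cat_Cons cat_add_left cat_scale_left algebra_simps)
qed

lemma cat_one_left [simp]: "cat_one \<otimes> p = p"
proof
  fix w
  have zero: "((\<lambda>u. 0) \<otimes> p) v = 0" for v by (simp add: cat_def)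
  show "(cat_one \<otimes> p) w = p w"
    by (cases w) (simp_all add: cat_Cons cat_one_def zero)
qed

lemma cat_one_right [simp]: "p \<otimes> cat_one = p"
proof
  fix w
  show "(p \<otimes> cat_one) w = p w"
    by (induction w arbitrary: p) (simp_all add: cat_Cons cat_one_def)
qed

section \<open>The resolvent as a two-sided inverse\<close>

lemma resolvent_eq_sum:
  assumes "length w < M"
  shows "resolvent q w = (\<Sum>n<M. resolvent_term q n w)"
  unfolding resolvent_def
  by (rule suminf_finite)
     (use assms in \<open>auto simp: resolvent_term_def cat_pow_eq_0 cat_one_def\<close>)

text \<open>
  In each coefficient the geometric series is a finite sum, so multiplying it by
  \<open>[] - q\<close> telescopes.
\<close>

lemma resolvent_right_inverse:
  fixes q :: "'d series"
  assumes "q [] \<noteq> 1"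
  shows "(\<lambda>v. cat_one v - q v) \<otimes> resolvent q = cat_one"
proof
  fix w :: "'d list"
  define c where "c = 1 - q []"
  define a where "a v = q v - q [] * cat_one v" for v
  define t where "t = resolvent_term q"
  define M where "M = Suc (length w)"
  have c: "c \<noteq> 0" using assms by (simp add: c_def)
  have t: "t n = (\<lambda>v. inverse c ^ (n + 1) * cat_pow a n v)" for n
    by (simp add: t_def resolvent_term_def[abs_def] c_def a_def[abs_def])
  have one_minus: "(\<lambda>v. cat_one v - q v) = (\<lambda>v. c * cat_one v - a v)"
    by (simp add: c_def a_def algebra_simps)
  have step: "((\<lambda>v. cat_one v - q v) \<otimes> t n) w = c * (t n w - t (Suc n) w)" for n
    using c unfolding one_minus cat_diff_left cat_scale_left
    by (simp add: t cat_scale_right right_diff_distrib)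
  have "((\<lambda>v. cat_one v - q v) \<otimes> resolvent q) w
      = ((\<lambda>v. cat_one v - q v) \<otimes> (\<lambda>v. \<Sum>n<M. t n v)) w"
    unfolding t_def by (intro cat_cong resolvent_eq_sum) (simp add: M_def)
  also have "\<dots> = c * (\<Sum>n<M. t n w - t (Suc n) w)"
    by (simp only: cat_sum_right step sum_distrib_left)
  also have "\<dots> = c * (t 0 w - t M w)"
    using sum_lessThan_telescope'[of "\<lambda>n. t n w" M] by simp
  also have "t M w = 0"
    unfolding t by (simp add: cat_pow_eq_0 a_def cat_one_def M_def del: cat_pow.simps)
  finally show "((\<lambda>v. cat_one v - q v) \<otimes> resolvent q) w = cat_one w"
    using c by (simp add: t)
qed

lemma resolvent_Nil: "resolvent q [] = inverse (1 - q [])"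
  by (simp add: resolvent_eq_sum[where M = 1] resolvent_term_def cat_one_def)

text \<open>
  The resolvent \<open>r\<close> of \<open>q\<close> is a right inverse of \<open>[] - q\<close> and has itself a right inverse, namely
  the resolvent of \<open>[] - r\<close>. In a monoid these two have to coincide.
\<close>

lemma resolvent_one_minus_resolvent:
  assumes "q [] \<noteq> 1"
  shows "resolvent (\<lambda>v. cat_one v - resolvent q v) = (\<lambda>v. cat_one v - q v)"
proof -
  let ?a = "\<lambda>v. cat_one v - q v"
  let ?r = "resolvent q"
  let ?c = "resolvent (\<lambda>v. cat_one v - ?r v)"
  have "?r \<otimes> ?c = cat_one"
    using resolvent_right_inverse[of "\<lambda>v. cat_one v - ?r v"] assms
    by (simp add: resolvent_Nil cat_one_def)
  then have "?a = (?a \<otimes> ?r) \<otimes> ?c" by (simp add: cat_assoc)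
  then show ?thesis using assms by (simp add: resolvent_right_inverse)
qed

lemma resolvent_left_inverse:
  assumes "q [] \<noteq> 1"
  shows "resolvent q \<otimes> (\<lambda>v. cat_one v - q v) = cat_one"
  using resolvent_right_inverse[of "\<lambda>v. cat_one v - resolvent q v"] assms
  by (simp add: resolvent_one_minus_resolvent resolvent_Nil cat_one_def[of "[]"])

lemma linear_equation_iff:
  assumes "q [] \<noteq> 1"
  shows "l = (\<lambda>v. p v + (l \<otimes> q) v) \<longleftrightarrow> l = p \<otimes> resolvent q"
proof -
  let ?a = "\<lambda>v. cat_one v - q v"
  have "l = (\<lambda>v. p v + (l \<otimes> q) v) \<longleftrightarrow> l \<otimes> ?a = p"
    by (auto simp: fun_eq_iff cat_diff_right algebra_simps)
  also have "\<dots> \<longleftrightarrow> l = p \<otimes> resolvent q"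
  proof
    assume "l \<otimes> ?a = p"
    then have "p \<otimes> resolvent q = l \<otimes> (?a \<otimes> resolvent q)"
      by (simp add: cat_assoc[symmetric])
    then show "l = p \<otimes> resolvent q" using assms by (simp add: resolvent_right_inverse)
  qed (use assms in \<open>simp add: cat_assoc resolvent_left_inverse\<close>)
  finally show ?thesis .
qed

section \<open>Weighted norms\<close>

text \<open>
  The norm is represented by its partial sums over the words of length less than \<open>N\<close>. They are
  finite sums, and since both factors of a short word are short, submultiplicativity holds at
  every fixed \<open>N\<close>.
\<close>

definition wnorm_upto :: "('d list \<Rightarrow> real) \<Rightarrow> nat \<Rightarrow> 'd::finite series \<Rightarrow> real" where
  "wnorm_upto H N l = (\<Sum>v | length v < N. \<bar>l v\<bar> * H v)"

definition finite_wnorm :: "('d list \<Rightarrow> real) \<Rightarrow> 'd::finite series \<Rightarrow> bool" where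
  "finite_wnorm H l \<longleftrightarrow> (\<exists>B. \<forall>N. wnorm_upto H N l \<le> B)"

lemma finite_words: "finite (words n :: 'd::finite list set)"
  using finite_lists_length_eq[of "UNIV :: 'd set" n] by (simp add: words_def)

lemma short_words_eq: "{v. length v < N} = (\<Union>n<N. words n)"
  by (auto simp: words_def)

lemma finite_short_words: "finite {v :: 'd::finite list. length v < N}"
  by (simp add: short_words_eq finite_words)

text \<open>
  A weight in which prepending a nonempty word to a long word \<open>v\<close> is cheap: the submultiplicative
  bound improves by a factor depending on the length of \<open>v\<close> and tending to \<open>0\<close>.
\<close>

locale decaying_weight =
  fixes H :: "'d::finite list \<Rightarrow> real" and g :: "nat \<Rightarrow> real"
  assumes weight_nonneg: "0 \<le> H v"
    and submult: "H (u @ v) \<le> H u * H v"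
    and submult_gain: "u \<noteq> [] \<Longrightarrow> H (u @ v) \<le> g (length v) * (H u * H v)"
    and gain_nonneg: "0 \<le> g n"
    and gain_antimono: "m \<le> n \<Longrightarrow> g n \<le> g m"
    and gain_tendsto_0: "g \<longlonglongrightarrow> 0"
begin

lemma wnorm_upto_nonneg: "0 \<le> wnorm_upto H N l"
  unfolding wnorm_upto_def by (intro sum_nonneg mult_nonneg_nonneg weight_nonneg) auto

lemma finite_wnorm_mono:
  assumes "finite_wnorm H p" and "\<And>v. \<bar>l v\<bar> \<le> \<bar>p v\<bar>"
  shows "finite_wnorm H l"
proof -
  have "wnorm_upto H N l \<le> wnorm_upto H N p" for N
    unfolding wnorm_upto_def by (intro sum_mono mult_right_mono assms weight_nonneg)
  with assms(1) show ?thesis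
    unfolding finite_wnorm_def by (meson order_trans)
qed

lemma wnorm_upto_one: "wnorm_upto H N cat_one \<le> H []"
proof -
  have "wnorm_upto H N cat_one = (\<Sum>v | length v < N. if v = [] then H v else 0)"
    unfolding wnorm_upto_def by (rule sum.cong) (auto simp: cat_one_def)
  also have "\<dots> \<le> H []"
    by (simp add: sum.delta' sum.delta finite_short_words weight_nonneg)
  finally show ?thesis .
qed

lemma finite_wnorm_one: "finite_wnorm H cat_one"
  unfolding finite_wnorm_def using wnorm_upto_one by blast

lemma finite_wnorm_diff:
  assumes "finite_wnorm H l" "finite_wnorm H p"
  shows "finite_wnorm H (\<lambda>v. l v - p v)"
proof -
  obtain B B' where B: "\<And>N. wnorm_upto H N l \<le> B" "\<And>N. wnorm_upto H N p \<le> B'"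
    using assms unfolding finite_wnorm_def by blast
  have "wnorm_upto H N (\<lambda>v. l v - p v) \<le> wnorm_upto H N l + wnorm_upto H N p" for N
    unfolding wnorm_upto_def sum.distrib[symmetric] distrib_right[symmetric]
    by (intro sum_mono mult_right_mono weight_nonneg abs_triangle_ineq4)
  also have "wnorm_upto H N l + wnorm_upto H N p \<le> B + B'" for N
    by (intro add_mono B)
  finally show ?thesis unfolding finite_wnorm_def by blast
qed

text \<open>
  The bound with \<open>K\<close> is restricted to the supports of the two factors so that it can exploit the
  length of the words in the support of a power.
\<close>

lemma wnorm_upto_cat:
  assumes K: "\<And>u v. l u \<noteq> 0 \<Longrightarrow> p v \<noteq> 0 \<Longrightarrow> H (u @ v) \<le> K * (H u * H v)" and "0 \<le> K"
  shows "wnorm_upto H N (l \<otimes> p) \<le> K * (wnorm_upto H N l * wnorm_upto H N p)"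
proof -
  let ?S = "{v :: 'd list. length v < N}"
  let ?f = "\<lambda>z. \<bar>l (fst z)\<bar> * \<bar>p (snd z)\<bar> * H (fst z @ snd z)"
  let ?P = "Sigma ?S (\<lambda>w. {(u, v). u @ v = w})"
  have "wnorm_upto H N (l \<otimes> p) \<le> (\<Sum>w\<in>?S. \<Sum>z\<in>{(u, v). u @ v = w}. ?f z)"
    unfolding wnorm_upto_def
  proof (rule sum_mono)
    fix w
    have "\<bar>(l \<otimes> p) w\<bar> * H w \<le> (\<Sum>z\<in>{(u, v). u @ v = w}. \<bar>l (fst z) * p (snd z)\<bar>) * H w"
      unfolding cat_def case_prod_unfold by (intro mult_right_mono sum_abs weight_nonneg)
    also have "\<dots> = (\<Sum>z\<in>{(u, v). u @ v = w}. ?f z)"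
      unfolding sum_distrib_right by (rule sum.cong) (auto simp: abs_mult)
    finally show "\<bar>(l \<otimes> p) w\<bar> * H w \<le> (\<Sum>z\<in>{(u, v). u @ v = w}. ?f z)" .
  qed
  also have "\<dots> = (\<Sum>y\<in>?P. ?f (snd y))"
    by (subst sum.Sigma) (use finite_splits in \<open>auto simp: finite_short_words case_prod_unfold\<close>)
  also have "\<dots> = (\<Sum>z\<in>snd ` ?P. ?f z)"
    by (subst sum.reindex) (auto simp: inj_on_def)
  also have "\<dots> \<le> (\<Sum>z\<in>?S \<times> ?S. ?f z)"
    by (intro sum_mono2 finite_cartesian_product finite_short_words
          mult_nonneg_nonneg weight_nonneg) auto
  also have "\<dots> \<le> (\<Sum>z\<in>?S \<times> ?S. K * ((\<bar>l (fst z)\<bar> * H (fst z)) * (\<bar>p (snd z)\<bar> * H (snd z))))"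
  proof (rule sum_mono)
    fix z :: "'d list \<times> 'd list"
    show "?f z \<le> K * ((\<bar>l (fst z)\<bar> * H (fst z)) * (\<bar>p (snd z)\<bar> * H (snd z)))"
    proof (cases "l (fst z) = 0 \<or> p (snd z) = 0")
      case False
      then have "?f z \<le> \<bar>l (fst z)\<bar> * \<bar>p (snd z)\<bar> * (K * (H (fst z) * H (snd z)))"
        by (intro mult_left_mono K) auto
      then show ?thesis by (simp add: mult_ac)
    qed auto
  qed
  also have "\<dots> = K * (wnorm_upto H N l * wnorm_upto H N p)"
    unfolding wnorm_upto_def
    by (subst sum_product, subst sum.cartesian_product)
       (simp add: sum_distrib_left case_prod_unfold)
  finally show ?thesis .
qed

lemma finite_wnorm_cat:
  assumes "finite_wnorm H l" "finite_wnorm H p"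
  shows "finite_wnorm H (l \<otimes> p)"
proof -
  obtain B B' where B: "\<And>N. wnorm_upto H N l \<le> B" "\<And>N. wnorm_upto H N p \<le> B'"
    using assms unfolding finite_wnorm_def by blast
  have "wnorm_upto H N (l \<otimes> p) \<le> B * B'" for N
  proof -
    have "wnorm_upto H N (l \<otimes> p) \<le> 1 * (wnorm_upto H N l * wnorm_upto H N p)"
      by (rule wnorm_upto_cat) (simp_all add: submult)
    also have "\<dots> \<le> B * B'"
      using B wnorm_upto_nonneg by (simp add: mult_mono')
    finally show ?thesis .
  qed
  then show ?thesis unfolding finite_wnorm_def by blast
qed

section \<open>Quasi-nilpotency of series without constant term\<close>

text \<open>
  The words in the support of the \<open>n\<close>-th power have length at least \<open>n\<close>, so the multiplication
  that leads to the next power gains the factor \<open>g n\<close>.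
\<close>

lemma wnorm_upto_cat_pow:
  assumes "a [] = 0" and B: "\<And>N. wnorm_upto H N a \<le> B"
  shows "wnorm_upto H N (cat_pow a n) \<le> H [] * (\<Prod>i<n. g i * B)"
proof (induction n)
  case 0
  then show ?case using wnorm_upto_one by simp
next
  case (Suc n)
  have "B \<ge> 0" using wnorm_upto_nonneg B order_trans by blast
  have "H (u @ v) \<le> g n * (H u * H v)" if "a u \<noteq> 0" "cat_pow a n v \<noteq> 0" for u v
  proof -
    have "u \<noteq> []" "n \<le> length v"
      using that assms(1) cat_pow_eq_0[of a v n] by (auto simp: not_less[symmetric])
    then have "H (u @ v) \<le> g (length v) * (H u * H v)" by (simp add: submult_gain)
    also have "\<dots> \<le> g n * (H u * H v)"
      using \<open>n \<le> length v\<close> by (intro mult_right_mono gain_antimono) (auto simp: weight_nonneg)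
    finally show ?thesis .
  qed
  then have "wnorm_upto H N (cat_pow a (Suc n))
      \<le> g n * (wnorm_upto H N a * wnorm_upto H N (cat_pow a n))"
    by (simp add: wnorm_upto_cat gain_nonneg)
  also have "\<dots> \<le> g n * (B * (H [] * (\<Prod>i<n. g i * B)))"
    using Suc B \<open>B \<ge> 0\<close> by (intro mult_left_mono mult_mono) (auto simp: gain_nonneg wnorm_upto_nonneg)
  finally show ?case by (simp add: mult_ac)
qed

lemma summable_prod_gain: "summable (\<lambda>n. c ^ Suc n * (H [] * (\<Prod>i<n. g i * B)))"
proof -
  have "(\<lambda>n. \<bar>c * (g n * B)\<bar>) \<longlonglongrightarrow> \<bar>c * (0 * B)\<bar>"
    by (intro tendsto_intros gain_tendsto_0)
  then have "eventually (\<lambda>n. \<bar>c * (g n * B)\<bar> < 1/2) sequentially"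
    by (intro order_tendstoD(2)) auto
  then obtain n0 where n0: "\<And>n. n \<ge> n0 \<Longrightarrow> \<bar>c * (g n * B)\<bar> < 1/2"
    unfolding eventually_sequentially by blast
  show ?thesis
  proof (rule summable_ratio_test[of "1/2" n0])
    fix n assume "n \<ge> n0"
    let ?f = "\<lambda>n. c ^ Suc n * (H [] * (\<Prod>i<n. g i * B))"
    have "norm (?f (Suc n)) = \<bar>c * (g n * B)\<bar> * norm (?f n)"
      by (simp add: abs_mult mult_ac)
    also have "\<dots> \<le> 1/2 * norm (?f n)"
      using n0[OF \<open>n \<ge> n0\<close>] by (intro mult_right_mono) auto
    finally show "norm (?f (Suc n)) \<le> 1/2 * norm (?f n)" .
  qed simp
qed

text \<open>
  Quasi-nilpotency makes the geometric series converge for every ratio, hence whatever the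
  constant term of \<open>l\<close>. For \<open>l [] = 1\<close> the convention \<open>inverse 0 = 0\<close> turns the resolvent into
  the zero series.
\<close>

lemma finite_wnorm_resolvent:
  assumes "finite_wnorm H l"
  shows "finite_wnorm H (resolvent l)"
proof -
  define c where "c = \<bar>inverse (1 - l [])\<bar>"
  define a where "a v = l v - l [] * cat_one v" for v
  have a0: "a [] = 0" by (simp add: a_def cat_one_def)
  have "finite_wnorm H a"
    by (rule finite_wnorm_mono[OF assms]) (auto simp: a_def cat_one_def)
  then obtain B where B: "\<And>N. wnorm_upto H N a \<le> B"
    unfolding finite_wnorm_def by blast
  have "B \<ge> 0" using wnorm_upto_nonneg B order_trans by blast
  let ?b = "\<lambda>n. c ^ Suc n * (H [] * (\<Prod>i<n. g i * B))"
  have b_nonneg: "0 \<le> ?b n" for n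
    using \<open>B \<ge> 0\<close> by (auto simp: c_def intro!: mult_nonneg_nonneg prod_nonneg weight_nonneg gain_nonneg)
  have "wnorm_upto H N (resolvent l) \<le> (\<Sum>n. ?b n)" for N
  proof -
    have "wnorm_upto H N (resolvent l)
        \<le> (\<Sum>v | length v < N. \<Sum>n<N. c ^ Suc n * (\<bar>cat_pow a n v\<bar> * H v))"
      unfolding wnorm_upto_def
    proof (rule sum_mono)
      fix v :: "'d list" assume "v \<in> {v. length v < N}"
      then have "\<bar>resolvent l v\<bar> * H v \<le> (\<Sum>n<N. \<bar>resolvent_term l n v\<bar>) * H v"
        by (intro mult_right_mono weight_nonneg) (simp add: resolvent_eq_sum[where M = N])
      also have "\<dots> = (\<Sum>n<N. c ^ Suc n * (\<bar>cat_pow a n v\<bar> * H v))"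
        by (simp add: sum_distrib_right resolvent_term_def abs_mult power_abs c_def a_def[abs_def]
            mult.assoc)
      finally show "\<bar>resolvent l v\<bar> * H v \<le> \<dots>" .
    qed
    also have "\<dots> = (\<Sum>n<N. c ^ Suc n * wnorm_upto H N (cat_pow a n))"
      unfolding wnorm_upto_def sum_distrib_left by (rule sum.swap)
    also have "\<dots> \<le> (\<Sum>n<N. ?b n)"
      by (intro sum_mono mult_left_mono wnorm_upto_cat_pow a0 B) (auto simp: c_def)
    also have "\<dots> \<le> (\<Sum>n. ?b n)"
      by (intro sum_le_suminf summable_prod_gain b_nonneg) simp
    finally show ?thesis .
  qed
  then show ?thesis unfolding finite_wnorm_def by blast
qed

end

section \<open>The signature weights\<close>

lemma fact_mult_fact_le:
  assumes "m \<ge> 1" "k \<ge> 1"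
  shows "fact m * fact k \<le> (fact (m + k - 1) :: real)"
  using assms(2)
proof (induction k rule: dec_induct)
  case base
  then show ?case by simp
next
  case (step k)
  obtain j where j: "m + k = Suc j" using assms(1) by (cases "m + k") auto
  have "fact m * fact (Suc k) = real (Suc k) * (fact m * fact k)" by (simp add: algebra_simps)
  also have "\<dots> \<le> real (Suc j) * fact j"
    using step j assms(1) by (intro mult_mono) auto
  finally show ?case using j by simp
qed

text \<open>
  The factorials contribute \<open>sqrt (m k)\<close>, where \<open>m\<close> and \<open>k\<close> are the exponents of the two words.
  Of this, \<open>sqrt k\<close> pays for the gain, and \<open>sqrt m\<close> together with \<open>C \<ge> 2\<close> pays for the fourth
  root belonging to the prefix.
\<close>

lemma h_weight_append:
  assumes "T > 0" "C \<ge> 2" "u \<noteq> []" "v \<noteq> []"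
  shows "h_weight C e T (u @ v) \<le> h_weight C e T u * h_weight C e T v / sqrt (length v)"
proof -
  define a b where "a = length u" and "b = length v"
  define m k where "m = a + count_list u e" and "k = b + count_list v e"
  have ab: "a \<ge> 1" "b \<ge> 1" using assms by (auto simp: a_def b_def Suc_le_eq)
  have mk: "m \<ge> 1" "k \<ge> 1" "a \<le> m" "b \<le> k" using ab by (auto simp: m_def k_def)
  define A B D where "A = (real a + 1) powr (1/4)" and "B = (real b + 1) powr (1/4)"
    and "D = (real (a + b) + 1) powr (1/4)"
  define F G L where "F = sqrt (fact (m - 1))" and "G = sqrt (fact (k - 1))"
    and "L = sqrt (fact (m + k - 1))"
  define s where "s = sqrt (2 * T)"
  have pos: "A > 0" "B > 0" "D > 0" "F > 0" "G > 0" "L > 0" "s > 0" "C > 0"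
    using assms by (auto simp: A_def B_def D_def F_def G_def L_def s_def)
  have "A \<le> (real a + 1) powr (1/2)"
    unfolding A_def by (intro powr_mono) auto
  also have "\<dots> = sqrt (real a + 1)" by (simp add: powr_half_sqrt)
  also have "\<dots> \<le> sqrt (4 * real m)" using mk by (intro real_sqrt_le_mono) linarith
  also have "\<dots> = 2 * sqrt m" by (simp add: real_sqrt_mult)
  also have "\<dots> \<le> C * sqrt m" using assms by (intro mult_right_mono) auto
  finally have "A \<le> C * sqrt m" .
  moreover have "B \<le> D" unfolding B_def D_def by (intro powr_mono2) auto
  ultimately have AB: "A * B \<le> C * sqrt m * D" using pos by (intro mult_mono) auto
  have "fact m = real m * fact (m - 1)" "fact k = real k * fact (k - 1)"
    using mk by (auto simp: fact_reduce)
  then have "real m * fact (m - 1) * (real k * fact (k - 1)) \<le> fact (m + k - 1)"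
    using fact_mult_fact_le[OF mk(1,2)] by simp
  then have "sqrt (real m * fact (m - 1) * (real k * fact (k - 1))) \<le> L"
    unfolding L_def by (rule real_sqrt_le_mono)
  then have "sqrt m * F * (sqrt k * G) \<le> L" by (simp add: F_def G_def real_sqrt_mult)
  moreover have "sqrt m * F * (sqrt b * G) \<le> sqrt m * F * (sqrt k * G)"
    using mk pos by (intro mult_left_mono mult_right_mono) auto
  ultimately have FG: "sqrt m * F * (sqrt b * G) \<le> L" by linarith
  have "sqrt m * (A * B * F * G * sqrt b) = A * B * (sqrt m * F * (sqrt b * G))"
    by (simp add: mult_ac)
  also have "\<dots> \<le> (C * sqrt m * D) * L"
    by (rule mult_mono[OF AB FG]) (use pos in auto)
  also have "\<dots> = sqrt m * (C * D * L)" by (simp add: mult_ac)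
  finally have key: "A * B * F * G * sqrt b \<le> C * D * L"
    using mk by simp
  have exps: "a + b + (count_list u e + count_list v e) = m + k" by (simp add: m_def k_def)
  have "h_weight C e T (u @ v) = C / D * (s ^ (m + k) / L)"
    unfolding h_weight_def Let_def length_append count_list_append
      a_def[symmetric] b_def[symmetric] exps D_def L_def s_def by simp
  also have "\<dots> = C * s ^ (m + k) / (D * L)" by simp
  also have "\<dots> \<le> C * s ^ (m + k) * C / (A * B * F * G * sqrt b)"
  proof -
    have "C * s ^ (m + k) * (A * B * F * G * sqrt b) \<le> C * s ^ (m + k) * (C * D * L)"
      using pos by (intro mult_left_mono key) auto
    then show ?thesis
      using pos ab by (simp add: field_simps)
  qed
  also have "\<dots> = (C / A * (s ^ m / F)) * (C / B * (s ^ k / G)) / sqrt b"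
    by (simp add: power_add mult_ac)
  also have "\<dots> = h_weight C e T u * h_weight C e T v / sqrt (length v)"
    by (simp add: h_weight_def Let_def A_def B_def F_def G_def m_def k_def s_def a_def b_def)
  finally show ?thesis .
qed

lemma decaying_weight_h_weight:
  assumes "T > 0" "C \<ge> 2"
  shows "decaying_weight (h_weight C e T) (\<lambda>n. 1 / sqrt (max 1 (real n)))"
proof
  let ?H = "h_weight C e T"
  show nonneg: "0 \<le> ?H v" for v using assms by (simp add: h_weight_def Let_def)
  have Nil: "?H [] = C" by (simp add: h_weight_def)
  show gain: "?H (u @ v) \<le> 1 / sqrt (max 1 (real (length v))) * (?H u * ?H v)"
    if "u \<noteq> []" for u v
  proof (cases "v = []")
    case True
    have "?H u * 1 \<le> ?H u * C" using assms nonneg by (intro mult_left_mono) auto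
    with True Nil show ?thesis by simp
  next
    case False
    then have "max 1 (real (length v)) = length v" by (cases v) auto
    then show ?thesis using h_weight_append[OF assms that False, of e] by simp
  qed
  show "?H (u @ v) \<le> ?H u * ?H v" for u v
  proof (cases "u = []")
    case True
    have "1 * ?H v \<le> C * ?H v" using assms nonneg by (intro mult_right_mono) auto
    with True Nil show ?thesis by simp
  next
    case False
    have "1 / sqrt (max 1 (real (length v))) * (?H u * ?H v) \<le> 1 * (?H u * ?H v)"
      by (intro mult_right_mono) (auto simp: nonneg)
    with gain[OF False, of v] show ?thesis by simp
  qed
  show "0 \<le> 1 / sqrt (max 1 (real n))" for n by simp
  show "1 / sqrt (max 1 (real n)) \<le> 1 / sqrt (max 1 (real m))" if "m \<le> n" for m n
    using that by (intro divide_left_mono) auto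
  have "(\<lambda>n. inverse (sqrt (real n))) \<longlonglongrightarrow> 0"
    by (intro tendsto_inverse_0_at_top filterlim_compose[OF sqrt_at_top] filterlim_real_sequentially)
  moreover have "eventually (\<lambda>n. inverse (sqrt (real n)) = 1 / sqrt (max 1 (real n))) sequentially"
    using eventually_ge_at_top[of 1] by eventually_elim (simp add: inverse_eq_divide max_def)
  ultimately show "(\<lambda>n. 1 / sqrt (max 1 (real n))) \<longlonglongrightarrow> 0"
    by (rule Lim_transform_eventually)
qed

lemma A_space_iff_finite_wnorm:
  assumes "T > 0" "C \<ge> 2"
  shows "l \<in> A_space C e T \<longleftrightarrow> finite_wnorm (h_weight C e T) l"
proof -
  let ?H = "h_weight C e T"
  let ?f = "\<lambda>n. \<Sum>v\<in>words n. ennreal (\<bar>l v\<bar> * ?H v)"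
  interpret decaying_weight ?H "\<lambda>n. 1 / sqrt (max 1 (real n))"
    using assms by (rule decaying_weight_h_weight)
  have partial: "(\<Sum>n<N. ?f n) = ennreal (wnorm_upto ?H N l)" for N
  proof -
    have "(\<Sum>n<N. ?f n) = (\<Sum>v | length v < N. ennreal (\<bar>l v\<bar> * ?H v))"
      unfolding short_words_eq
      by (subst sum.UNION_disjoint) (auto simp: finite_words, auto simp: words_def)
    also have "\<dots> = ennreal (wnorm_upto ?H N l)"
      unfolding wnorm_upto_def by (rule sum_ennreal) (simp add: weight_nonneg)
    finally show ?thesis .
  qed
  show ?thesis
  proof
    assume "l \<in> A_space C e T"
    then have fin: "A_norm C e T l < \<infinity>" by (simp add: A_space_def)
    have "wnorm_upto ?H N l \<le> enn2real (A_norm C e T l)" for N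
    proof -
      have "ennreal (wnorm_upto ?H N l) \<le> A_norm C e T l"
        unfolding partial[symmetric] A_norm_def by (rule sum_le_suminf) auto
      then have "enn2real (ennreal (wnorm_upto ?H N l)) \<le> enn2real (A_norm C e T l)"
        using fin by (intro enn2real_mono) auto
      then show ?thesis by (simp add: wnorm_upto_nonneg)
    qed
    then show "finite_wnorm ?H l" unfolding finite_wnorm_def by blast
  next
    assume "finite_wnorm ?H l"
    then obtain B where "\<And>N. wnorm_upto ?H N l \<le> B" unfolding finite_wnorm_def by blast
    then have "A_norm C e T l \<le> ennreal B"
      unfolding A_norm_def by (intro suminf_le_const) (auto simp: partial ennreal_leI)
    then show "l \<in> A_space C e T"
      unfolding A_space_def by (auto intro: le_less_trans)
  qed
qed

section \<open>The linear equation\<close>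

theorem theorem3p9:
  fixes e :: "'d::finite" and p q :: "'d series" and C T :: real
  assumes "CARD('d) \<ge> 2" and "T > 0" and "C \<ge> 2"
    and "p \<in> A_space C e T"
    and "\<bar>q []\<bar> < 1"
    and "\<exists>\<phi> :: 'd series. resolvent_defined \<phi> \<and> q \<preceq> \<phi> \<and> resolvent \<phi> \<in> A_space C e T"
  shows "resolvent_defined q \<and> resolvent q \<in> A_space C e T \<and>
         (\<exists>!l :: 'd series. l = (\<lambda>v. p v + (l \<otimes> q) v)) \<and>
         (\<forall>l :: 'd series. l = (\<lambda>v. p v + (l \<otimes> q) v) \<longrightarrow> l \<in> A_space C e T)"
proof -
  interpret decaying_weight "h_weight C e T" "\<lambda>n. 1 / sqrt (max 1 (real n))"
    using assms(2,3) by (rule decaying_weight_h_weight)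
  note A_iff = A_space_iff_finite_wnorm[OF assms(2,3)]
  have q: "q [] \<noteq> 1" using assms(5) by auto
  obtain \<phi> where \<phi>: "\<phi> [] \<noteq> 1" "q \<preceq> \<phi>" "finite_wnorm (h_weight C e T) (resolvent \<phi>)"
    using assms(6) by (auto simp: resolvent_defined_iff A_iff)
  have "finite_wnorm (h_weight C e T) (\<lambda>v. cat_one v - \<phi> v)"
    using finite_wnorm_resolvent[OF finite_wnorm_diff[OF finite_wnorm_one \<phi>(3)]]
    by (simp add: resolvent_one_minus_resolvent \<phi>(1))
  from finite_wnorm_diff[OF finite_wnorm_one this]
  have "finite_wnorm (h_weight C e T) \<phi>" by simp
  then have "finite_wnorm (h_weight C e T) q"
    by (rule finite_wnorm_mono) (use \<phi>(2) in \<open>auto simp: dominated_def intro: order_trans\<close>)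
  then have r: "finite_wnorm (h_weight C e T) (resolvent q)"
    by (rule finite_wnorm_resolvent)
  moreover have "finite_wnorm (h_weight C e T) (p \<otimes> resolvent q)"
    using assms(4) r by (intro finite_wnorm_cat) (simp_all add: A_iff)
  ultimately show ?thesis
    by (simp add: linear_equation_iff[of q] resolvent_defined_iff q A_iff)
qed

end
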